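(* Let $\alpha\in\mathbb{R}$, let $N\ge 0$ be an integer and let $f:\mathbb{R}\to\mathbb{R}$ be continuously differentiable. With $\boldsymbol{\omega}_N$ and $D_N$ as in the context, the system of $4N+2$ ordinary differential equations for $\mathbf{q}_N,\mathbf{p}_N:[0,\infty)\to\mathbb{R}^{2N+1}$ $$\dot{\mathbf{q}}_N(t)=\mathbf{p}_N(t),\qquad \dot{\mathbf{p}}_N(t)=-\alpha^2D_N\mathbf{q}_N(t)-\int_0^1\boldsymbol{\omega}_N(x)\,f'\big(\boldsymbol{\omega}_N(x)^\top\mathbf{q}_N(t)\big)\,dx,\qquad t>0,$$ is Hamiltonian with Hamiltonian $$H_N(\mathbf{q}_N,\mathbf{p}_N)=\frac12\mathbf{p}_N^\top\mathbf{p}_N+\frac{\alpha^2}{2}\mathbf{q}_N^\top D_N\mathbf{q}_N+\int_0^1 f\big(\boldsymbol{\omega}_N(x)^\top\mathbf{q}_N\big)\,dx,$$ that is, the system coincides with $\dot{\mathbf{q}}_N=\nabla_{\mathbf{p}_N}H_N(\mathbf{q}_N,\mathbf{p}_N)$, $\dot{\mathbf{p}}_N=-\nabla_{\mathbf{q}_N}H_N(\mathbf{q}_N,\mathbf{p}_N)$. Moreover, $H_N$ is the functional $\mathcal{H}$ evaluated on truncated Fourier expansions: if $u_N(x,t)=\boldsymbol{\omega}_N(x)^\top\mathbf{q}_N(t)$ with $\mathbf{q}_N$ differentiable in $t$, $\mathbf{p}_N=\dot{\mathbf{q}}_N$ and $v_N=\partial_t u_N$, then for all $t$ $$H_N(\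mathbf{q}_N(t),\mathbf{p}_N(t))=\mathcal{H}[u_N,v_N](t).$$
   Context: The trigonometric functions on $[0,1]$ are $c_0(x)\equiv1$, $c_k(x)=\sqrt2\cos(2k\pi x)$, $s_k(x)=\sqrt2\sin(2k\pi x)$ for $k\ge1$. Define $$\boldsymbol{\omega}_N(x)=(c_0(x),c_1(x),s_1(x),c_2(x),s_2(x),\dots,c_N(x),s_N(x))^\top\in\mathbb{R}^{2N+1},$$ and the diagonal matrix $$D_N=\mathrm{diag}\big(0,(2\pi)^2,(2\pi)^2,(4\pi)^2,(4\pi)^2,\dots,(2N\pi)^2,(2N\pi)^2\big)\in\mathbb{R}^{(2N+1)\times(2N+1)}.$$ For functions $u,v$ of $(x,t)$, the energy functional of the nonlinear wave equation $u_{tt}=\alpha^2u_{xx}-f'(u)$ is $$\mathcal{H}[u,v](t)=\int_0^1\Big[\tfrac12v(x,t)^2+\tfrac12\alpha^2u_x(x,t)^2+f(u(x,t))\Big]dx,\qquad v=u_t.$$ *)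

theory Defs
  imports "HOL-Analysis.Analysis"
begin

text \<open>
  Vectors in dimension \<open>2 N + 1\<close> have type \<open>real ^ 'n\<close> with \<open>CARD('n) = 2 * N + 1\<close>. The linear order
  on the index type fixes which coordinate is the first, the second, and so on: \<open>pos i\<close> is the
  0-based position of the index \<open>i\<close>. The numeral types \<open>1\<close>, \<open>3\<close>, \<open>5\<close>, \<dots> are suitable index types.
\<close>

definition pos :: "'n::{finite,linorder} \<Rightarrow> nat" where
  "pos i = card {j. j < i}"

lemma pos_less_iff: "pos i < pos j \<longleftrightarrow> i < (j :: 'n::{finite,linorder})"
proof -
  have mono: "pos i < pos j" if "i < j" for i j :: 'n
    unfolding pos_def using that by (intro psubset_card_mono) auto
  then show ?thesis
    by (metis less_asym neqE)
qed

lemma bij_betw_pos: "bij_betw (pos :: 'n::{finite,linorder} \<Rightarrow> nat) UNIV {..<CARD('n)}"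
proof -
  have inj: "inj (pos :: 'n \<Rightarrow> nat)"
    by (rule injI) (metis pos_less_iff less_irrefl neqE)
  have "pos i < CARD('n)" for i :: 'n
    unfolding pos_def by (intro psubset_card_mono) auto
  then have "range (pos :: 'n \<Rightarrow> nat) = {..<CARD('n)}"
    by (intro card_subset_eq) (auto simp: card_image[OF inj])
  with inj show ?thesis
    by (simp add: bij_betw_def)
qed

definition cos_mode :: "nat \<Rightarrow> real \<Rightarrow> real" where
  "cos_mode k x = (if k = 0 then 1 else sqrt 2 * cos (2 * real k * pi * x))"

definition sin_mode :: "nat \<Rightarrow> real \<Rightarrow> real" where
  "sin_mode k x = sqrt 2 * sin (2 * real k * pi * x)"

text \<open>The sequence \<open>c 0, c 1, s 1, c 2, s 2, \<dots>\<close>; its \<open>m\<close>-th member has frequency \<open>(m + 1) div 2\<close>.\<close>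

definition trig_mode :: "nat \<Rightarrow> real \<Rightarrow> real" where
  "trig_mode m x = (if m = 0 \<or> odd m then cos_mode ((m + 1) div 2) x else sin_mode (m div 2) x)"

lemma trig_mode_list:
  "map (\<lambda>m. trig_mode m x) [0..<2 * N + 1] =
     cos_mode 0 x # concat (map (\<lambda>k. [cos_mode k x, sin_mode k x]) [1..<N + 1])"
  proof (induction N)
  case (Suc N)
  have "[0..<2 * Suc N + 1] = [0..<2 * N + 1] @ [2 * N + 1, 2 * N + 2]"
    by simp
  with Suc show ?case
    by (simp add: trig_mode_def del: upt_Suc) (simp add: trig_mode_def)
qed (simp add: trig_mode_def)

definition omega :: "real \<Rightarrow> real ^ 'n::{finite,linorder}" where
  "omega x = (\<chi> i. trig_mode (pos i) x)"

definition eigval :: "nat \<Rightarrow> real" where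
  "eigval m = (2 * real ((m + 1) div 2) * pi)\<^sup>2"

lemma eigval_list:
  "map eigval [0..<2 * N + 1] =
     0 # concat (map (\<lambda>k. [(2 * real k * pi)\<^sup>2, (2 * real k * pi)\<^sup>2]) [1..<N + 1])"
  proof (induction N)
  case (Suc N)
  have "[0..<2 * Suc N + 1] = [0..<2 * N + 1] @ [2 * N + 1, 2 * N + 2]"
    by simp
  with Suc show ?case
    by (simp add: eigval_def del: upt_Suc) (simp add: eigval_def)
qed (simp add: eigval_def)

definition D_mat :: "real ^ 'n::{finite,linorder} ^ 'n::{finite,linorder}" where
  "D_mat = (\<chi> i j. if i = j then eigval (pos i) else 0)"

definition q_rhs :: "'a \<Rightarrow> 'a \<Rightarrow> 'a" where
  "q_rhs q p = p"

text \<open>Here \<open>f'\<close> is the derivative of the nonlinearity \<open>f\<close>.\<close>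

definition p_rhs ::
    "real \<Rightarrow> (real \<Rightarrow> real) \<Rightarrow> real ^ 'n::{finite,linorder} \<Rightarrow> real ^ 'n::{finite,linorder} \<Rightarrow> real ^ 'n::{finite,linorder}" where
  "p_rhs \<alpha> f' q p =
     - (\<alpha>\<^sup>2 *\<^sub>R (D_mat *v q)) - integral {0..1} (\<lambda>x. f' (omega x \<bullet> q) *\<^sub>R omega x)"

definition hamiltonian ::
    "real \<Rightarrow> (real \<Rightarrow> real) \<Rightarrow> real ^ 'n::{finite,linorder} \<Rightarrow> real ^ 'n::{finite,linorder} \<Rightarrow> real" where
  "hamiltonian \<alpha> f q p =
     1 / 2 * (p \<bullet> p) + \<alpha>\<^sup>2 / 2 * (q \<bullet> (D_mat *v q)) + integral {0..1} (\<lambda>x. f (omega x \<bullet> q))"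

definition solves_system ::
    "('a \<Rightarrow> 'a \<Rightarrow> 'a) \<Rightarrow> ('a \<Rightarrow> 'a \<Rightarrow> 'a) \<Rightarrow> (real \<Rightarrow> 'a) \<Rightarrow> (real \<Rightarrow> 'a::real_normed_vector) \<Rightarrow> bool" where
  "solves_system F G q p \<longleftrightarrow>
     (\<forall>t>0. (q has_vector_derivative F (q t) (p t)) (at t) \<and>
            (p has_vector_derivative G (q t) (p t)) (at t))"

definition solves_hamilton_equations ::
    "('a \<Rightarrow> 'a \<Rightarrow> real) \<Rightarrow> (real \<Rightarrow> 'a) \<Rightarrow> (real \<Rightarrow> 'a::real_inner) \<Rightarrow> bool" where
  "solves_hamilton_equations H q p \<longleftrightarrow>
     (\<forall>t>0. \<exists>Hp Hq. GDERIV (\<lambda>y. H (q t) y) (p t) :> Hp \<and> GDERIV (\<lambda>y. H y (p t)) (q t) :> Hq \<and>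
            (q has_vector_derivative Hp) (at t) \<and> (p has_vector_derivative - Hq) (at t))"

text \<open>The vector field \<open>(F, G)\<close> is the Hamiltonian one at every point of phase space.\<close>

definition is_hamiltonian_system ::
    "('a \<Rightarrow> 'a \<Rightarrow> 'a) \<Rightarrow> ('a \<Rightarrow> 'a \<Rightarrow> 'a) \<Rightarrow> ('a::real_inner \<Rightarrow> 'a \<Rightarrow> real) \<Rightarrow> bool" where
  "is_hamiltonian_system F G H \<longleftrightarrow>
     (\<forall>q p. \<exists>Hp Hq. GDERIV (\<lambda>y. H q y) p :> Hp \<and> GDERIV (\<lambda>y. H y p) q :> Hq \<and>
            F q p = Hp \<and> G q p = - Hq)"

text \<open>
  Partial derivatives of functions on \<open>{0..1} \<times> {0..}\<close>; they are one-sided at the boundary.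
\<close>

definition partial_x :: "(real \<Rightarrow> real \<Rightarrow> real) \<Rightarrow> real \<Rightarrow> real \<Rightarrow> real" where
  "partial_x u x t = vector_derivative (\<lambda>y. u y t) (at x within {0..1})"

definition partial_t :: "(real \<Rightarrow> real \<Rightarrow> real) \<Rightarrow> real \<Rightarrow> real \<Rightarrow> real" where
  "partial_t u x t = vector_derivative (\<lambda>s. u x s) (at t within {0..})"

definition energy ::
    "real \<Rightarrow> (real \<Rightarrow> real) \<Rightarrow> (real \<Rightarrow> real \<Rightarrow> real) \<Rightarrow> (real \<Rightarrow> real \<Rightarrow> real) \<Rightarrow> real \<Rightarrow> real" where
  "energy \<alpha> f u v t =
     integral {0..1} (\<lambda>x. 1 / 2 * (v x t)\<^sup>2 + 1 / 2 * \<alpha>\<^sup>2 * (partial_x u x t)\<^sup>2 + f (u x t))"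

definition trunc_fourier ::
    "(real \<Rightarrow> real ^ 'n::{finite,linorder}) \<Rightarrow> real \<Rightarrow> real \<Rightarrow> real" where
  "trunc_fourier q x t = omega x \<bullet> q t"

end

theory Submission
  imports Defs
begin

text \<open>
  Why the system is Hamiltonian: the gradient of \<open>H\<^sub>N\<close> in \<open>p\<close> is \<open>p\<close>, the gradient of the quadratic
  form of the symmetric matrix \<open>D\<^sub>N\<close> is \<open>2 D\<^sub>N q\<close>, and the integral of \<open>f (\<omega>\<^sub>N(x) \<bullet> q)\<close> may be
  differentiated under the integral sign because \<open>f'\<close> is continuous (\<open>GDERIV_integral\<close>). So
  \<open>q_rhs\<close> and \<open>p_rhs\<close> are the gradients of \<open>H\<^sub>N\<close> with the right signs at every point of phase space.
  Since gradients are unique (\<open>GDERIV_unique\<close>), a curve solves the system exactly if it satisfies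
  Hamilton's equations.

  Why \<open>H\<^sub>N\<close> is the energy of the truncated expansions: \<open>v\<^sub>N = \<omega>\<^sub>N(x) \<bullet> p\<close> and
  \<open>\<partial>\<^sub>x u\<^sub>N = \<omega>\<^sub>N'(x) \<bullet> q\<close>, so each of the two quadratic terms of the energy is the integral of the
  square of a linear combination of fixed functions, hence the quadratic form of their Gram matrix
  (\<open>has_integral_inner_square\<close>). The modes are orthonormal in \<open>L\<^sup>2\<close> of the unit interval, so the Gram
  matrix of \<open>\<omega>\<^sub>N\<close> is the identity. The one of \<open>\<omega>\<^sub>N'\<close> is \<open>D\<^sub>N\<close>: the modes are 1-periodic
  eigenfunctions, \<open>- w\<^sub>m'' = (eigval m) w\<^sub>m\<close>, and integration by parts turns the integral of
  \<open>w\<^sub>a' w\<^sub>b'\<close> into that of \<open>- w\<^sub>a'' w\<^sub>b\<close>, with no boundary terms.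
\<close>

section \<open>Gradients\<close>

lemma GDERIV_unique:
  assumes "GDERIV f x :> D" and "GDERIV f x :> D'"
  shows "D = D'"
proof -
  have "(\<lambda>h. h \<bullet> D) = (\<lambda>h. h \<bullet> D')"
    using assms unfolding gderiv_def by (rule has_derivative_unique)
  then show ?thesis
    by (metis inner_commute vector_eq_ldot)
qed

text \<open>
  The Leibniz rule for gradients: representing a functional by its inner product with a vector is a
  bounded linear operation, so it commutes with integration.
\<close>

lemma GDERIV_integral:
  fixes F :: "'a::euclidean_space \<Rightarrow> 'b::euclidean_space \<Rightarrow> real"
  assumes deriv: "\<And>y t. t \<in> cbox a b \<Longrightarrow> GDERIV (\<lambda>y. F y t) y :> G y t"
    and int: "\<And>y. F y integrable_on cbox a b"
    and cont: "continuous_on (UNIV \<times> cbox a b) (\<lambda>(y, t). G y t)"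
  shows "GDERIV (\<lambda>y. integral (cbox a b) (F y)) x :> integral (cbox a b) (G x)"
proof -
  let ?L = "\<lambda>y t. blinfun_inner_left (G y t)"
  have "continuous_on (cbox a b) (\<lambda>t. (\<lambda>(y, t). G y t) (x, t))"
    by (rule continuous_on_compose2[OF cont]) (auto intro!: continuous_intros)
  then have contx: "continuous_on (cbox a b) (G x)"
    by simp
  have "((\<lambda>y. integral (cbox a b) (F y)) has_derivative integral (cbox a b) (?L x)) (at x within UNIV)"
  proof (rule leibniz_rule)
    show "((\<lambda>y. F y t) has_derivative ?L y t) (at y within UNIV)" if "t \<in> cbox a b" for y t
      using deriv[OF that, of y] unfolding gderiv_def blinfun_inner_left.rep_eq by simp
    show "continuous_on (UNIV \<times> cbox a b) (\<lambda>(y, t). ?L y t)"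
      using cont by (auto simp: split_beta
          intro!: bounded_linear.continuous_on[OF bounded_linear_blinfun_inner_left])
  qed (use int in auto)
  moreover have "integral (cbox a b) (?L x) = blinfun_inner_left (integral (cbox a b) (G x))"
    using integral_linear[OF integrable_continuous[OF contx] bounded_linear_blinfun_inner_left]
    by (simp add: o_def)
  ultimately show ?thesis
    by (simp add: gderiv_def blinfun_inner_left.rep_eq[abs_def])
qed

text \<open>
  For a curve, being driven by the vector field and satisfying Hamilton's equations only differ in
  the latter choosing some gradient, and there is no choice.
\<close>

lemma is_hamiltonian_system_imp_solves_iff:
  assumes "is_hamiltonian_system F G H"
  shows "solves_system F G q p \<longleftrightarrow> solves_hamilton_equations H q p"
proof -
  have "GDERIV (\<lambda>y. H a y) b :> D \<longleftrightarrow> D = F a b"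
    and "GDERIV (\<lambda>y. H y b) a :> D \<longleftrightarrow> D = - G a b" for a b D
  proof -
    obtain Hp Hq where "GDERIV (\<lambda>y. H a y) b :> Hp" "GDERIV (\<lambda>y. H y b) a :> Hq"
        "F a b = Hp" "- G a b = Hq"
      using assms unfolding is_hamiltonian_system_def by fastforce
    then show "GDERIV (\<lambda>y. H a y) b :> D \<longleftrightarrow> D = F a b"
      and "GDERIV (\<lambda>y. H y b) a :> D \<longleftrightarrow> D = - G a b"
      by (auto dest: GDERIV_unique)
  qed
  then show ?thesis
    unfolding solves_system_def solves_hamilton_equations_def by simp
qed

section \<open>The Hamiltonian vector field\<close>

lemma GDERIV_inner_self: "GDERIV (\<lambda>y. y \<bullet> y) x :> 2 *\<^sub>R x"
  unfolding gderiv_def by (auto intro!: derivative_eq_intros simp: inner_commute)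

lemma GDERIV_quadratic_form:
  fixes A :: "real ^ 'n ^ 'n"
  assumes "transpose A = A"
  shows "GDERIV (\<lambda>y. y \<bullet> (A *v y)) x :> 2 *\<^sub>R (A *v x)"
proof -
  have "x \<bullet> (A *v h) = h \<bullet> (A *v x)" for h
    using assms by (metis dot_lmul_matrix inner_commute transpose_matrix_vector)
  then show ?thesis
    unfolding gderiv_def
    by (auto intro!: derivative_eq_intros bounded_linear.has_derivative[OF matrix_vector_mul_bounded_linear])
qed

lemma transpose_D_mat: "transpose D_mat = D_mat"
  by (simp add: transpose_def D_mat_def vec_eq_iff)

lemma trig_mode_eq_cos_mode: "m = 0 \<or> odd m \<Longrightarrow> trig_mode m = cos_mode ((m + 1) div 2)"
  by (simp add: trig_mode_def fun_eq_iff)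

lemma trig_mode_eq_sin_mode: "\<not> (m = 0 \<or> odd m) \<Longrightarrow> trig_mode m = sin_mode (m div 2)"
  by (simp add: trig_mode_def fun_eq_iff)

lemma continuous_on_cos_mode:
  fixes g :: "'a::t2_space \<Rightarrow> real"
  shows "continuous_on S g \<Longrightarrow> continuous_on S (\<lambda>x. cos_mode k (g x))"
  unfolding cos_mode_def by (cases "k = 0") (simp_all add: continuous_intros)

lemma continuous_on_sin_mode:
  fixes g :: "'a::t2_space \<Rightarrow> real"
  shows "continuous_on S g \<Longrightarrow> continuous_on S (\<lambda>x. sin_mode k (g x))"
  unfolding sin_mode_def by (intro continuous_intros)

lemma continuous_on_trig_mode [continuous_intros]:
  fixes g :: "'a::t2_space \<Rightarrow> real"
  shows "continuous_on S g \<Longrightarrow> continuous_on S (\<lambda>x. trig_mode m (g x))"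
  by (metis trig_mode_eq_cos_mode trig_mode_eq_sin_mode continuous_on_cos_mode continuous_on_sin_mode)

lemma continuous_on_omega [continuous_intros]:
  fixes g :: "'a::t2_space \<Rightarrow> real"
  shows "continuous_on S g \<Longrightarrow> continuous_on S (\<lambda>x. omega (g x))"
  unfolding omega_def by (intro continuous_intros)

lemma GDERIV_potential:
  fixes q :: "real ^ 'n::{finite,linorder}"
  assumes f: "\<And>y. (f has_real_derivative f' y) (at y)"
    and f': "continuous_on UNIV f'"
  shows "GDERIV (\<lambda>q. integral {0..1} (\<lambda>x. f (omega x \<bullet> q))) q :>
           integral {0..1} (\<lambda>x. f' (omega x \<bullet> q) *\<^sub>R omega x)"
proof -
  have f_cont: "continuous_on UNIV f"
    using f by (meson DERIV_isCont continuous_at_imp_continuous_on)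
  show ?thesis
    unfolding cbox_interval[symmetric]
  proof (rule GDERIV_integral)
    fix y :: "real ^ 'n::{finite,linorder}" and t :: real
    have "GDERIV (\<lambda>y. omega t \<bullet> y) y :> omega t"
      unfolding gderiv_def by (auto intro!: derivative_eq_intros simp: inner_commute)
    from GDERIV_DERIV_compose[OF this f]
    show "GDERIV (\<lambda>y. f (omega t \<bullet> y)) y :> f' (omega t \<bullet> y) *\<^sub>R omega t" .
  next
    show "(\<lambda>t. f (omega t \<bullet> y)) integrable_on cbox 0 1" for y :: "real ^ 'n::{finite,linorder}"
      by (intro integrable_continuous continuous_on_compose2[OF f_cont] continuous_intros) auto
    show "continuous_on (UNIV \<times> cbox 0 1)
            (\<lambda>(y :: real ^ 'n::{finite,linorder}, t). f' (omega t \<bullet> y) *\<^sub>R omega t)"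
      unfolding split_beta
      by (intro continuous_intros continuous_on_compose2[OF f']) auto
  qed
qed

lemma hamiltonian_is_hamiltonian_system:
  assumes f: "\<And>y. (f has_real_derivative f' y) (at y)"
    and f': "continuous_on UNIV f'"
  shows "is_hamiltonian_system q_rhs (p_rhs \<alpha> f')
           (hamiltonian \<alpha> f :: real ^ 'n::{finite,linorder} \<Rightarrow> real ^ 'n::{finite,linorder} \<Rightarrow> real)"
  unfolding is_hamiltonian_system_def
proof (intro allI exI conjI)
  fix q p :: "real ^ 'n::{finite,linorder}"
  have "GDERIV (\<lambda>y. 1 / 2 * (y \<bullet> y)) p :> p"
    using GDERIV_mult[OF GDERIV_const GDERIV_inner_self, of "1 / 2" p] by simp
  from GDERIV_add[OF GDERIV_add[OF this GDERIV_const] GDERIV_const]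
  show "GDERIV (hamiltonian \<alpha> f q) p :> q_rhs q p"
    unfolding hamiltonian_def q_rhs_def by simp
  have "GDERIV (\<lambda>y. \<alpha>\<^sup>2 / 2 * (y \<bullet> (D_mat *v y))) q :> \<alpha>\<^sup>2 *\<^sub>R (D_mat *v q)"
    using GDERIV_mult[OF GDERIV_const GDERIV_quadratic_form[OF transpose_D_mat], of "\<alpha>\<^sup>2 / 2" q] by simp
  from GDERIV_add[OF GDERIV_add[OF GDERIV_const this] GDERIV_potential[OF f f']]
  show "GDERIV (\<lambda>y. hamiltonian \<alpha> f y p) q :> - p_rhs \<alpha> f' q p"
    unfolding hamiltonian_def p_rhs_def by (simp add: add.commute)
qed simp_all

section \<open>Orthonormality of the trigonometric modes\<close>

lemma has_integral_cos_period:
  "((\<lambda>x. cos (2 * real_of_int n * pi * x)) has_integral (if n = 0 then 1 else 0)) {0..1}"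
proof (cases "n = 0")
  case True
  then show ?thesis
    using has_integral_const_real[of "1::real" 0 1] by simp
next
  case False
  let ?S = "\<lambda>x. sin (2 * real_of_int n * pi * x) / (2 * real_of_int n * pi)"
  have "((\<lambda>x. cos (2 * real_of_int n * pi * x)) has_integral (?S 1 - ?S 0)) {0..1}"
    using False
    by (intro fundamental_theorem_of_calculus)
      (auto intro!: derivative_eq_intros simp flip: has_real_derivative_iff_has_vector_derivative)
  moreover have "sin (2 * real_of_int n * pi) = 0"
    using sin_int_2pin[of n] by (simp add: mult_ac)
  ultimately show ?thesis
    using False by simp
qed

lemma has_integral_sin_period:
  "((\<lambda>x. sin (2 * real_of_int n * pi * x)) has_integral 0) {0..1}"
proof (cases "n = 0")
  case False
  let ?C = "\<lambda>x. - cos (2 * real_of_int n * pi * x) / (2 * real_of_int n * pi)"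
  have "((\<lambda>x. sin (2 * real_of_int n * pi * x)) has_integral (?C 1 - ?C 0)) {0..1}"
    using False
    by (intro fundamental_theorem_of_calculus)
      (auto intro!: derivative_eq_intros simp flip: has_real_derivative_iff_has_vector_derivative)
  moreover have "cos (2 * real_of_int n * pi) = 1"
    using cos_int_2pin[of n] by (simp add: mult_ac)
  ultimately show ?thesis
    by simp
qed simp

text \<open>
  The product-to-sum formulas reduce each product of modes to functions integrated over full
  periods; only frequency zero contributes. The factors \<open>1\<close> and \<open>sqrt 2\<close> make the diagonal
  integrals equal to \<open>1\<close>.
\<close>

lemma has_integral_cos_mode_cos_mode:
  "((\<lambda>x. cos_mode j x * cos_mode k x) has_integral (if j = k then 1 else 0)) {0..1}"
proof -
  \<comment> \<open>the normalisation; only the constant mode lacks the factor \<open>sqrt 2\<close>\<close>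
  define c where "c i = (if i = 0 then 1 else sqrt 2)" for i :: nat
  let ?C = "\<lambda>n x. cos (2 * real_of_int n * pi * x)"
  have mode: "cos_mode i x = c i * cos (2 * real i * pi * x)" for i x
    by (simp add: cos_mode_def c_def)
  have "cos_mode j x * cos_mode k x =
      c j * c k / 2 * (?C (int j - int k) x + ?C (int j + int k) x)" for x
  proof -
    have "cos_mode j x * cos_mode k x =
        c j * c k * (cos (2 * real j * pi * x) * cos (2 * real k * pi * x))"
      by (simp add: mode)
    also have "cos (2 * real j * pi * x) * cos (2 * real k * pi * x) =
        (?C (int j - int k) x + ?C (int j + int k) x) / 2"
      by (subst cos_times_cos) (simp add: algebra_simps)
    finally show ?thesis
      by simp
  qed
  moreover have "((\<lambda>x. c j * c k / 2 * (?C (int j - int k) x + ?C (int j + int k) x)) has_integral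
      c j * c k / 2 * ((if int j - int k = 0 then 1 else 0) + (if int j + int k = 0 then 1 else 0))) {0..1}"
    by (intro has_integral_mult_right has_integral_add has_integral_cos_period)
  moreover have "c j * c k / 2 *
      ((if int j - int k = 0 then 1 else 0) + (if int j + int k = 0 then 1 else 0)) =
      (if j = k then 1 else 0)"
    by (auto simp: c_def)
  ultimately show ?thesis
    by (simp only:)
qed

lemma has_integral_sin_mode_sin_mode:
  assumes "k > 0"
  shows "((\<lambda>x. sin_mode j x * sin_mode k x) has_integral (if j = k then 1 else 0)) {0..1}"
proof -
  let ?C = "\<lambda>n x. cos (2 * real_of_int n * pi * x)"
  have "sin_mode j x * sin_mode k x = ?C (int j - int k) x - ?C (int j + int k) x" for x
  proof -
    have "sin_mode j x * sin_mode k x =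
        2 * (sin (2 * real j * pi * x) * sin (2 * real k * pi * x))"
      by (simp add: sin_mode_def)
    also have "sin (2 * real j * pi * x) * sin (2 * real k * pi * x) =
        (?C (int j - int k) x - ?C (int j + int k) x) / 2"
      by (subst sin_times_sin) (simp add: algebra_simps)
    finally show ?thesis
      by simp
  qed
  moreover have "((\<lambda>x. ?C (int j - int k) x - ?C (int j + int k) x) has_integral
      (if int j - int k = 0 then 1 else 0) - (if int j + int k = 0 then 1 else 0)) {0..1}"
    by (intro has_integral_diff has_integral_cos_period)
  moreover have "(if int j - int k = 0 then 1 else 0) - (if int j + int k = 0 then 1 else 0) =
      (if j = k then 1 else (0::real))"
    using assms by auto
  ultimately show ?thesis
    by (simp only:)
qed

lemma has_integral_sin_mode_cos_mode:
  "((\<lambda>x. sin_mode j x * cos_mode k x) has_integral 0) {0..1}"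
proof -
  define c where "c = (if k = 0 then 1 else sqrt 2)"
  let ?S = "\<lambda>n x. sin (2 * real_of_int n * pi * x)"
  have "sin_mode j x * cos_mode k x =
      sqrt 2 * c / 2 * (?S (int j + int k) x + ?S (int j - int k) x)" for x
  proof -
    have "sin_mode j x * cos_mode k x =
        sqrt 2 * c * (sin (2 * real j * pi * x) * cos (2 * real k * pi * x))"
      by (simp add: sin_mode_def cos_mode_def c_def)
    also have "sin (2 * real j * pi * x) * cos (2 * real k * pi * x) =
        (?S (int j + int k) x + ?S (int j - int k) x) / 2"
      by (subst sin_times_cos) (simp add: algebra_simps)
    finally show ?thesis
      by simp
  qed
  moreover have "((\<lambda>x. sqrt 2 * c / 2 * (?S (int j + int k) x + ?S (int j - int k) x)) has_integral
      sqrt 2 * c / 2 * (0 + 0)) {0..1}"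
    by (intro has_integral_mult_right has_integral_add has_integral_sin_period)
  ultimately show ?thesis
    by (simp only: add_0_left mult_zero_right)
qed

text \<open>Two distinct modes differ in their frequency or in being a cosine or a sine.\<close>

lemma has_integral_trig_mode_trig_mode:
  "((\<lambda>x. trig_mode a x * trig_mode b x) has_integral (if a = b then 1 else 0)) {0..1}"
proof -
  let ?cosine = "\<lambda>m::nat. m = 0 \<or> odd m"
  show ?thesis
  proof (cases "?cosine a"; cases "?cosine b")
    assume ab: "?cosine a" "?cosine b"
    then have "(a + 1) div 2 = (b + 1) div 2 \<longleftrightarrow> a = b"
      by (auto elim!: oddE)
    then show ?thesis
      using has_integral_cos_mode_cos_mode[of "(a + 1) div 2" "(b + 1) div 2"]
      by (simp only: trig_mode_eq_cos_mode[OF ab(1)] trig_mode_eq_cos_mode[OF ab(2)])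
  next
    assume ab: "?cosine a" "\<not> ?cosine b"
    then have "(if a = b then 1 else 0) = (0::real)"
      by auto
    then show ?thesis
      using has_integral_sin_mode_cos_mode[of "b div 2" "(a + 1) div 2"]
      by (simp only: trig_mode_eq_cos_mode[OF ab(1)] trig_mode_eq_sin_mode[OF ab(2)] mult.commute)
  next
    assume ab: "\<not> ?cosine a" "?cosine b"
    then have "(if a = b then 1 else 0) = (0::real)"
      by auto
    then show ?thesis
      using has_integral_sin_mode_cos_mode[of "a div 2" "(b + 1) div 2"]
      by (simp only: trig_mode_eq_sin_mode[OF ab(1)] trig_mode_eq_cos_mode[OF ab(2)])
  next
    assume ab: "\<not> ?cosine a" "\<not> ?cosine b"
    then have "a div 2 = b div 2 \<longleftrightarrow> a = b" "b div 2 > 0"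
      by (auto elim!: evenE)
    then show ?thesis
      using has_integral_sin_mode_sin_mode[of "b div 2" "a div 2"]
      by (simp only: trig_mode_eq_sin_mode[OF ab(1)] trig_mode_eq_sin_mode[OF ab(2)])
  qed
qed

section \<open>Derivatives of the modes\<close>

definition trig_mode_deriv :: "nat \<Rightarrow> real \<Rightarrow> real" where
  "trig_mode_deriv m x =
     (let k = (m + 1) div 2 in
      2 * real k * pi * (if m = 0 \<or> odd m then - sin_mode k x else cos_mode k x))"

lemma has_real_derivative_cos_mode:
  "(cos_mode k has_real_derivative - (2 * real k * pi * sin_mode k x)) (at x within S)"
  unfolding cos_mode_def[abs_def] sin_mode_def
  by (cases "k = 0") (auto intro!: derivative_eq_intros)

lemma has_real_derivative_sin_mode:
  "(sin_mode k has_real_derivative 2 * real k * pi * cos_mode k x) (at x within S)"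
  unfolding cos_mode_def sin_mode_def[abs_def]
  by (cases "k = 0") (auto intro!: derivative_eq_intros)

lemma has_real_derivative_trig_mode:
  "(trig_mode m has_real_derivative trig_mode_deriv m x) (at x within S)"
proof (cases "m = 0 \<or> odd m")
  case True
  then show ?thesis
    using has_real_derivative_cos_mode[of "(m + 1) div 2"]
    by (simp add: trig_mode_def[abs_def] trig_mode_deriv_def Let_def)
next
  case False
  then have "(m + 1) div 2 = m div 2"
    by presburger
  then show ?thesis
    using False has_real_derivative_sin_mode[of "m div 2"]
    by (simp add: trig_mode_def[abs_def] trig_mode_deriv_def Let_def)
qed

text \<open>
  This eigenvalue relation is the origin of the entries of \<open>D\<^sub>N\<close>: the integration by parts below
  turns it into the Gram matrix of the derivatives.
\<close>

lemma has_real_derivative_trig_mode_deriv: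
  "(trig_mode_deriv m has_real_derivative - eigval m * trig_mode m x) (at x within S)"
proof (cases "m = 0 \<or> odd m")
  case True
  let ?k = "(m + 1) div 2"
  have "((\<lambda>x. 2 * real ?k * pi * - sin_mode ?k x) has_real_derivative
      2 * real ?k * pi * - (2 * real ?k * pi * cos_mode ?k x)) (at x within S)"
    by (intro DERIV_cmult DERIV_minus has_real_derivative_sin_mode)
  then show ?thesis
    using True
    by (simp add: trig_mode_def trig_mode_deriv_def[abs_def] Let_def eigval_def power2_eq_square mult_ac)
next
  case False
  let ?k = "m div 2"
  have "(m + 1) div 2 = ?k"
    using False by presburger
  moreover have "((\<lambda>x. 2 * real ?k * pi * cos_mode ?k x) has_real_derivative
      2 * real ?k * pi * - (2 * real ?k * pi * sin_mode ?k x)) (at x within S)"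
    by (intro DERIV_cmult has_real_derivative_cos_mode)
  ultimately show ?thesis
    using False
    by (simp add: trig_mode_def trig_mode_deriv_def[abs_def] Let_def eigval_def power2_eq_square mult_ac)
qed

lemma cos_mode_periodic: "cos_mode k 1 = cos_mode k 0"
  using cos_int_2pin[of "int k"] by (simp add: cos_mode_def mult_ac)

lemma sin_mode_periodic: "sin_mode k 1 = sin_mode k 0"
  using sin_int_2pin[of "int k"] by (simp add: sin_mode_def mult_ac)

lemma trig_mode_periodic: "trig_mode m 1 = trig_mode m 0"
  by (simp add: trig_mode_def cos_mode_periodic sin_mode_periodic)

lemma trig_mode_deriv_periodic: "trig_mode_deriv m 1 = trig_mode_deriv m 0"
  by (simp add: trig_mode_deriv_def cos_mode_periodic sin_mode_periodic Let_def)

text \<open>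
  Integration by parts in disguise: \<open>w\<^sub>a' w\<^sub>b\<close> has derivative \<open>- (eigval a) w\<^sub>a w\<^sub>b + w\<^sub>a' w\<^sub>b'\<close> and
  takes the same value at both ends of the period.
\<close>

lemma has_integral_trig_mode_deriv_trig_mode_deriv:
  "((\<lambda>x. trig_mode_deriv a x * trig_mode_deriv b x) has_integral
     (if a = b then eigval a else 0)) {0..1}"
proof -
  let ?P = "\<lambda>x. trig_mode_deriv a x * trig_mode b x"
  have "((\<lambda>x. - eigval a * trig_mode a x * trig_mode b x + trig_mode_deriv a x * trig_mode_deriv b x)
      has_integral (?P 1 - ?P 0)) {0..1}"
    by (intro fundamental_theorem_of_calculus)
      (auto intro!: derivative_eq_intros has_real_derivative_trig_mode has_real_derivative_trig_mode_deriv
        simp flip: has_real_derivative_iff_has_vector_derivative)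
  from has_integral_add[OF this has_integral_mult_right[OF has_integral_trig_mode_trig_mode[of a b], of "eigval a"]]
  show ?thesis
    by (simp add: trig_mode_periodic trig_mode_deriv_periodic mult.assoc if_distrib cong: if_cong)
qed

section \<open>The energy of truncated Fourier expansions\<close>

text \<open>
  Expanding the square leaves only the pairwise integrals of the components of \<open>w\<close>, so the
  matrix \<open>A\<close> is their Gram matrix. Both quadratic terms of the energy are of this form.
\<close>

lemma has_integral_inner_square:
  fixes w :: "real \<Rightarrow> real ^ 'n" and A :: "real ^ 'n ^ 'n"
  assumes "\<And>i j. ((\<lambda>x. w x $ i * w x $ j) has_integral A $ i $ j) S"
  shows "((\<lambda>x. (w x \<bullet> p)\<^sup>2) has_integral p \<bullet> (A *v p)) S"
proof -
  have "((\<lambda>x. \<Sum>i\<in>UNIV. \<Sum>j\<in>UNIV. (p $ i * p $ j) * (w x $ i * w x $ j)) has_integral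
      (\<Sum>i\<in>UNIV. \<Sum>j\<in>UNIV. (p $ i * p $ j) * A $ i $ j)) S"
    by (intro has_integral_sum has_integral_mult_right assms) auto
  moreover have "(w x \<bullet> p)\<^sup>2 = (\<Sum>i\<in>UNIV. \<Sum>j\<in>UNIV. (p $ i * p $ j) * (w x $ i * w x $ j))" for x
    by (simp add: inner_vec_def power2_eq_square sum_product mult_ac)
  moreover have "p \<bullet> (A *v p) = (\<Sum>i\<in>UNIV. \<Sum>j\<in>UNIV. (p $ i * p $ j) * A $ i $ j)"
    by (simp add: inner_vec_def matrix_vector_mult_def sum_distrib_left mult_ac)
  ultimately show ?thesis
    by simp
qed

lemma pos_eq_iff: "pos i = pos j \<longleftrightarrow> i = (j :: 'n::{finite,linorder})"
  using bij_betw_pos by (auto simp: bij_betw_def inj_def)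

lemma has_integral_omega_square:
  "((\<lambda>x. (omega x \<bullet> p)\<^sup>2) has_integral p \<bullet> p) {0..1}"
proof -
  have "((\<lambda>x. (omega x \<bullet> p)\<^sup>2) has_integral p \<bullet> (mat 1 *v p)) {0..1}"
  proof (rule has_integral_inner_square)
    show "((\<lambda>x. omega x $ i * omega x $ j) has_integral mat 1 $ i $ j) {0..1}" for i j
      using has_integral_trig_mode_trig_mode[of "pos i" "pos j"]
      by (simp add: omega_def mat_def pos_eq_iff)
  qed
  then show ?thesis
    by simp
qed

definition omega_deriv :: "real \<Rightarrow> real ^ 'n::{finite,linorder}" where
  "omega_deriv x = (\<chi> i. trig_mode_deriv (pos i) x)"

lemma has_integral_omega_deriv_square:
  "((\<lambda>x. (omega_deriv x \<bullet> q)\<^sup>2) has_integral q \<bullet> (D_mat *v q)) {0..1}"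
proof (rule has_integral_inner_square)
  show "((\<lambda>x. omega_deriv x $ i * omega_deriv x $ j) has_integral D_mat $ i $ j) {0..1}" for i j
    using has_integral_trig_mode_deriv_trig_mode_deriv[of "pos i" "pos j"]
    by (simp add: omega_deriv_def D_mat_def pos_eq_iff)
qed

lemma partial_x_trunc_fourier:
  assumes "x \<in> {0..1}"
  shows "partial_x (trunc_fourier q) x t = omega_deriv x \<bullet> q t"
  unfolding partial_x_def trunc_fourier_def
proof (rule vector_derivative_within_closed_interval)
  show "((\<lambda>y. omega y \<bullet> q t) has_vector_derivative omega_deriv x \<bullet> q t) (at x within {0..1})"
    unfolding inner_vec_def omega_def omega_deriv_def
      has_real_derivative_iff_has_vector_derivative[symmetric]
    by (auto intro!: derivative_eq_intros has_real_derivative_trig_mode)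
qed (use assms in auto)

lemma partial_t_trunc_fourier:
  assumes "t \<ge> 0" and "(q has_vector_derivative p t) (at t within {0..})"
  shows "partial_t (trunc_fourier q) x t = omega x \<bullet> p t"
  unfolding partial_t_def trunc_fourier_def
proof (rule vector_derivative_within)
  \<comment> \<open>this covers \<open>t = 0\<close>, where the derivative is one-sided\<close>
  have "at t within {t..t + 1} \<noteq> bot"
    by (simp add: trivial_limit_within islimpt_Icc)
  then show "at t within {0..} \<noteq> bot"
    using assms(1) at_le[of "{t..t + 1}" "{0..}" t] by (auto simp: bot_unique)
  show "((\<lambda>s. omega x \<bullet> q s) has_vector_derivative omega x \<bullet> p t) (at t within {0..})"
    using assms(2) by (rule bounded_linear.has_vector_derivative[OF bounded_linear_inner_right])
qed

lemma hamiltonian_eq_energy: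
  fixes q p :: "real \<Rightarrow> real ^ 'n::{finite,linorder}"
  assumes f: "continuous_on UNIV f"
    and t: "t \<ge> 0" and q: "(q has_vector_derivative p t) (at t within {0..})"
  shows "hamiltonian \<alpha> f (q t) (p t) =
           energy \<alpha> f (trunc_fourier q) (partial_t (trunc_fourier q)) t"
proof -
  have "(\<lambda>x. f (omega x \<bullet> q t)) integrable_on {0..1}"
    by (intro integrable_continuous_interval continuous_on_compose2[OF f] continuous_intros) auto
  then have potential: "((\<lambda>x. f (omega x \<bullet> q t)) has_integral
      integral {0..1} (\<lambda>x. f (omega x \<bullet> q t))) {0..1}"
    by (rule integrable_integral)
  have "((\<lambda>x. 1 / 2 * (omega x \<bullet> p t)\<^sup>2 + 1 / 2 * \<alpha>\<^sup>2 * (omega_deriv x \<bullet> q t)\<^sup>2 + f (omega x \<bullet> q t))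
      has_integral 1 / 2 * (p t \<bullet> p t) + 1 / 2 * \<alpha>\<^sup>2 * (q t \<bullet> (D_mat *v q t)) +
        integral {0..1} (\<lambda>x. f (omega x \<bullet> q t))) {0..1}"
    by (intro has_integral_add has_integral_mult_right has_integral_omega_square
        has_integral_omega_deriv_square potential)
  then have integral: "((\<lambda>x. 1 / 2 * (omega x \<bullet> p t)\<^sup>2 + 1 / 2 * \<alpha>\<^sup>2 * (omega_deriv x \<bullet> q t)\<^sup>2 +
      f (omega x \<bullet> q t)) has_integral hamiltonian \<alpha> f (q t) (p t)) {0..1}"
    by (simp add: hamiltonian_def)
  have "energy \<alpha> f (trunc_fourier q) (partial_t (trunc_fourier q)) t =
      integral {0..1} (\<lambda>x. 1 / 2 * (omega x \<bullet> p t)\<^sup>2 + 1 / 2 * \<alpha>\<^sup>2 * (omega_deriv x \<bullet> q t)\<^sup>2 +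
        f (omega x \<bullet> q t))"
    unfolding energy_def
    by (intro integral_cong)
      (simp add: partial_x_trunc_fourier partial_t_trunc_fourier[of t q p, OF t q] trunc_fourier_def)
  also have "\<dots> = hamiltonian \<alpha> f (q t) (p t)"
    using integral by (rule integral_unique)
  finally show ?thesis ..
qed

theorem theorem2:
  fixes \<alpha> :: real and N :: nat and f f' :: "real \<Rightarrow> real"
  assumes "CARD('n::{finite,linorder}) = 2 * N + 1"
    and "\<And>y. (f has_real_derivative f' y) (at y)"
    and "continuous_on UNIV f'"
  shows
    "is_hamiltonian_system q_rhs (p_rhs \<alpha> f')
       (hamiltonian \<alpha> f :: real ^ 'n::{finite,linorder} \<Rightarrow> real ^ 'n::{finite,linorder} \<Rightarrow> real) \<and>
     (\<forall>q p :: real \<Rightarrow> real ^ 'n::{finite,linorder}.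
        solves_system q_rhs (p_rhs \<alpha> f') q p \<longleftrightarrow>
        solves_hamilton_equations (hamiltonian \<alpha> f) q p) \<and>
     (\<forall>q p :: real \<Rightarrow> real ^ 'n::{finite,linorder}.
        (\<forall>t\<ge>0. (q has_vector_derivative p t) (at t within {0..})) \<longrightarrow>
        (\<forall>t\<ge>0. hamiltonian \<alpha> f (q t) (p t) =
           energy \<alpha> f (trunc_fourier q) (partial_t (trunc_fourier q)) t))"
proof -
  have "continuous_on UNIV f"
    using assms(2) by (meson DERIV_isCont continuous_at_imp_continuous_on)
  moreover have "is_hamiltonian_system q_rhs (p_rhs \<alpha> f')
      (hamiltonian \<alpha> f :: real ^ 'n::{finite,linorder} \<Rightarrow> real ^ 'n::{finite,linorder} \<Rightarrow> real)"
    using assms(2,3) by (rule hamiltonian_is_hamiltonian_system)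
  ultimately show ?thesis
    by (intro conjI allI impI is_hamiltonian_system_imp_solves_iff hamiltonian_eq_energy) simp_all
qed

end
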